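(* For any graph $G$ of order $n\ge 2$ with complement $\overline G$: (1) $\operatorname{th}_{\operatorname{Z}}(G)\cdot\operatorname{th}_{\operatorname{Z}}(\overline G)\le n^2$. (2) If each of $G$ and $\overline G$ has an edge, then $\operatorname{th}_{\operatorname{Z}}^{\ast}(G)+\operatorname{th}_{\operatorname{Z}}^{\ast}(\overline G)\le 2(n-1)$ and $\operatorname{th}_{\operatorname{Z}}^{\ast}(G)\cdot\operatorname{th}_{\operatorname{Z}}^{\ast}(\overline G)\le (n-1)^2$. All these bounds are sharp, i.e., each is attained by infinitely many graphs.
   Context: Graphs are finite, simple, undirected, with nonempty vertex set; the order of $G$ is $|V(G)|$; $\overline G$ is the complement of $G$. Standard zero forcing: each vertex is filled or unfilled. Color change rule: if $w$ is the unique unfilled neighbor of a filled vertex $v$, then fill $w$. For $B\subseteq V(G)$ put $B^{[0]}=B$, and let $B^{[i+1]}$ be $B^{[i]}$ together with all vertices that can be filled by one application of the rule when exactly the vertices of $B^{[i]}$ are filled. $\operatorname{pt}_{\operatorname{Z}}(G;B)$ is the least $t$ with $B^{[t]}=V(G)$ ($\infty$ if none exists), and $\operatorname{pt}_{\operatorname{Z}}(G,k)=\min_{|B|=k}\operatorname{pt}_{\operatorname{Z}}(G;B)$. For $G$ of order $n$: the sum throttling number is $\operatorname{th}_{\operatorname{Z}}(G)=\min_{1\le k\le n}(k+\operatorname{pt}_{\operatorname{Z}}(G,k))$, and, if $G$ has an edge, the no initial cost product throttling number is $\operatorname{th}_{\operatorname{Z}}^{\ast}(G)=\min_{1\le k\le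 n-1}k\cdot\operatorname{pt}_{\operatorname{Z}}(G,k)$. *)

theory Defs
  imports
    "HOL-Library.Extended_Nat"
    "Graph_Theory.Pair_Digraph"
    "Graph_Theory.Digraph_Isomorphism"
begin

text \<open>
  A finite simple undirected graph is a \<^locale>\<open>pair_graph\<close>: a finite loop-free symmetric
  relation on a finite vertex set, each undirected edge being the two opposite arcs.
  The locale admits the empty graph, which has to be excluded where it matters.
\<close>

abbreviation order :: "'a pair_pre_digraph \<Rightarrow> nat" where
  "order G \<equiv> card (pverts G)"

definition has_edge :: "'a pair_pre_digraph \<Rightarrow> bool" where
  "has_edge G \<longleftrightarrow> parcs G \<noteq> {}"

definition complement :: "'a pair_pre_digraph \<Rightarrow> 'a pair_pre_digraph" where
  "complement G = \<lparr> pverts = pverts G,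
     parcs = {(u, v). u \<in> pverts G \<and> v \<in> pverts G \<and> u \<noteq> v \<and> (u, v) \<notin> parcs G} \<rparr>"

definition neighbors :: "'a pair_pre_digraph \<Rightarrow> 'a \<Rightarrow> 'a set" where
  "neighbors G v = {w. (v, w) \<in> parcs G}"

text \<open>
  One simultaneous round of the color change rule: \<open>S\<close> is the set of filled vertices, and
  \<open>w\<close> is filled if it is the unique unfilled neighbor of some filled \<open>v\<close>.
\<close>

definition zf_step :: "'a pair_pre_digraph \<Rightarrow> 'a set \<Rightarrow> 'a set" where
  "zf_step G S = S \<union> {w. \<exists>v\<in>S. neighbors G v - S = {w}}"

primrec zf_iter :: "'a pair_pre_digraph \<Rightarrow> 'a set \<Rightarrow> nat \<Rightarrow> 'a set" where
  "zf_iter G B 0 = B"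
| "zf_iter G B (Suc i) = zf_step G (zf_iter G B i)"

definition pt_set :: "'a pair_pre_digraph \<Rightarrow> 'a set \<Rightarrow> enat" where
  "pt_set G B =
     (if \<exists>t. zf_iter G B t = pverts G then enat (LEAST t. zf_iter G B t = pverts G) else \<infinity>)"

text \<open>
  The minima below range over finite sets. They are nonempty for \<open>k \<le> order G\<close> in \<open>pt\<close>,
  \<open>order G \<ge> 1\<close> in \<open>th\<close> and \<open>order G \<ge> 2\<close> in \<open>th_star\<close>.
\<close>

definition pt :: "'a pair_pre_digraph \<Rightarrow> nat \<Rightarrow> enat" where
  "pt G k = Min (pt_set G ` {B. B \<subseteq> pverts G \<and> card B = k})"

definition th :: "'a pair_pre_digraph \<Rightarrow> enat" where
  "th G = Min ((\<lambda>k. enat k + pt G k) ` {1..order G})"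

definition th_star :: "'a pair_pre_digraph \<Rightarrow> enat" where
  "th_star G = Min ((\<lambda>k. enat k * pt G k) ` {1..order G - 1})"

text \<open>
  Infinitely many graphs are counted up to isomorphism. Every finite graph has a copy with
  vertices in \<^typ>\<open>nat\<close>, so nothing is lost by this choice of vertex type.
\<close>

definition infinitely_many_graphs :: "(nat pair_pre_digraph \<Rightarrow> bool) \<Rightarrow> bool" where
  "infinitely_many_graphs P \<longleftrightarrow>
     (\<exists>\<G>. infinite \<G> \<and> (\<forall>G\<in>\<G>. pair_graph G \<and> pverts G \<noteq> {} \<and> P G) \<and>
       (\<forall>G\<in>\<G>. \<forall>H\<in>\<G>. G \<noteq> H \<longrightarrow> \<not> digraph_iso (with_proj G) (with_proj H)))"

lemma pair_graph_complement:
  assumes "pair_graph G"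
  shows "pair_graph (complement G)"
proof -
  interpret pair_graph G by fact
  have "parcs (complement G) \<subseteq> pverts G \<times> pverts G"
    by (auto simp: complement_def)
  then have "finite (parcs (complement G))"
    using pair_finite_verts by (meson finite_SigmaI finite_subset)
  then show ?thesis
    using pair_finite_verts arcs_symmetric
    by unfold_locales (auto simp: complement_def symmetric_def intro!: symI)
qed

end

theory Submission
  imports Defs
begin

text \<open>
  The upper bounds come from filling all vertices, respectively all but one nonisolated vertex.
  For sharpness take the stars \<open>K(1, n)\<close>. In a star and in its complement all vertices other
  than the center \<open>c\<close> are pairwise twins, and two unfilled twins remain unfilled forever.
  So a set missing three vertices never fills the graph, and a set missing two of them needs
  at least two rounds, since \<open>c\<close> and a twin cannot be forced simultaneously. Hence
  \<open>th\<close> equals the order and \<open>th_star\<close> equals the order minus one.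
\<close>

lemma pverts_complement [simp]: "pverts (complement G) = pverts G"
  by (simp add: complement_def)

section \<open>Bounding propagation times and throttling numbers\<close>

lemma pt_set_le:
  assumes "zf_iter G B t = pverts G"
  shows "pt_set G B \<le> enat t"
  using assms by (auto simp: pt_set_def intro: Least_le)

lemma pt_set_ge:
  assumes "\<And>t. zf_iter G B t = pverts G \<Longrightarrow> m \<le> t"
  shows "enat m \<le> pt_set G B"
  using assms LeastI_ex[of "\<lambda>t. zf_iter G B t = pverts G"] by (auto simp: pt_set_def)

lemma pt_le:
  assumes "finite (pverts G)" "B \<subseteq> pverts G"
  shows "pt G (card B) \<le> pt_set G B"
  unfolding pt_def using assms by (intro Min_le) auto

text \<open>The bound on \<open>k\<close> guarantees that some \<open>B\<close> of that size exists,
  so that \<open>Min\<close> is taken over a nonempty set.\<close>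

lemma pt_ge:
  assumes "finite (pverts G)" "k \<le> order G"
    and "\<And>B. B \<subseteq> pverts G \<Longrightarrow> card B = k \<Longrightarrow> x \<le> pt_set G B"
  shows "x \<le> pt G k"
proof -
  obtain B where "B \<subseteq> pverts G" "card B = k"
    using obtain_subset_with_card_n[OF assms(2)] by blast
  then have "{B. B \<subseteq> pverts G \<and> card B = k} \<noteq> {}" by blast
  with assms show ?thesis
    unfolding pt_def by (intro Min.boundedI) auto
qed

lemma th_ge:
  assumes "order G \<ge> 1" "\<And>k. k \<in> {1..order G} \<Longrightarrow> x \<le> enat k + pt G k"
  shows "x \<le> th G"
  unfolding th_def using assms by (intro Min.boundedI) auto

lemma th_star_ge:
  assumes "order G \<ge> 2" "\<And>k. k \<in> {1..order G - 1} \<Longrightarrow> x \<le> enat k * pt G k"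
  shows "x \<le> th_star G"
  unfolding th_star_def using assms by (intro Min.boundedI) auto

section \<open>Upper bounds valid for every graph\<close>

lemma th_le_order:
  assumes "finite (pverts G)" "order G \<ge> 1"
  shows "th G \<le> enat (order G)"
proof -
  have "pt G (order G) \<le> pt_set G (pverts G)"
    using assms(1) by (rule pt_le) simp
  also have "\<dots> \<le> enat 0"
    by (rule pt_set_le) simp
  finally have "pt G (order G) = 0"
    by (simp add: zero_enat_def[symmetric])
  moreover have "th G \<le> enat (order G) + pt G (order G)"
    unfolding th_def using assms by (intro Min_le) auto
  ultimately show ?thesis by simp
qed

lemma th_star_le_order:
  assumes "pair_graph G" "has_edge G"
  shows "th_star G \<le> enat (order G - 1)"
proof -
  interpret pair_graph G by fact
  obtain v w where vw: "(v, w) \<in> parcs G"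
    using assms(2) by (auto simp: has_edge_def)
  then have mem: "v \<in> pverts G" "w \<in> pverts G" and "v \<noteq> w"
    using in_arcsD1 in_arcsD2 no_loops by fastforce+
  \<comment> \<open>The only unfilled vertex is an endpoint of an edge, so its neighbor
    \<open>v\<close> forces it in the first round.\<close>
  define B where "B = pverts G - {w}"
  have card: "card B = order G - 1"
    using mem by (simp add: B_def)
  \<comment> \<open>With two distinct vertices, \<open>order G - 1\<close> is at least 1 and so lies
    in the range of the minimum in \<open>th_star\<close>.\<close>
  have "card {v, w} \<le> order G"
    using mem by (intro card_mono) auto
  then have ge: "order G \<ge> 2"
    using \<open>v \<noteq> w\<close> by simp
  have nb: "neighbors G x \<subseteq> pverts G" for x
    using in_arcsD2 by (auto simp: neighbors_def)
  have "neighbors G v - B = {w}"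
    using nb[of v] vw by (auto simp: B_def neighbors_def)
  moreover have "v \<in> B"
    using mem \<open>v \<noteq> w\<close> by (simp add: B_def)
  ultimately have "w \<in> zf_step G B"
    by (auto simp: zf_step_def)
  moreover have "zf_step G B \<subseteq> pverts G"
    using nb by (fastforce simp: zf_step_def B_def)
  moreover have "B \<subseteq> zf_step G B"
    by (auto simp: zf_step_def)
  ultimately have "zf_iter G B 1 = pverts G"
    by (auto simp: B_def)
  then have "pt_set G B \<le> enat 1"
    by (rule pt_set_le)
  moreover have "pt G (card B) \<le> pt_set G B"
    by (rule pt_le) (auto simp: B_def)
  ultimately have "pt G (order G - 1) \<le> 1"
    by (simp add: card one_enat_def)
  then have "enat (order G - 1) * pt G (order G - 1) \<le> enat (order G - 1) * 1"
    by (rule mult_left_mono) simp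
  moreover have "th_star G \<le> enat (order G - 1) * pt G (order G - 1)"
    unfolding th_star_def using ge by (intro Min_le) auto
  ultimately show ?thesis by simp
qed

section \<open>Twins block zero forcing\<close>

text \<open>While \<open>u\<close> and \<open>w\<close> are both unfilled, every filled vertex
  differs from both and hence sees both or neither, so neither is ever a unique unfilled neighbor.
  Whether \<open>u\<close> and \<open>w\<close> are adjacent is left open: the leaves of a star are
  nonadjacent twins, and in its complement they are adjacent ones.\<close>

lemma unfilled_twins:
  assumes "\<And>x. x \<noteq> u \<Longrightarrow> x \<noteq> w \<Longrightarrow> u \<in> neighbors G x \<longleftrightarrow> w \<in> neighbors G x"
    and "u \<noteq> w" "u \<notin> B" "w \<notin> B"
  shows "u \<notin> zf_iter G B t \<and> w \<notin> zf_iter G B t"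
proof (induction t)
  case (Suc t)
  let ?S = "zf_iter G B t"
  have iff: "u \<in> neighbors G x - ?S \<longleftrightarrow> w \<in> neighbors G x - ?S" if "x \<in> ?S" for x
  proof -
    have "x \<noteq> u" "x \<noteq> w" using Suc that by auto
    from assms(1)[OF this] Suc show ?thesis by simp
  qed
  have "neighbors G x - ?S \<noteq> {u}" "neighbors G x - ?S \<noteq> {w}" if "x \<in> ?S" for x
    using iff[OF that] assms(2) by (metis singletonD singletonI)+
  with Suc show ?case by (simp add: zf_step_def)
qed (simp add: assms)

lemma pt_set_twins:
  assumes "\<And>x. x \<noteq> u \<Longrightarrow> x \<noteq> w \<Longrightarrow> u \<in> neighbors G x \<longleftrightarrow> w \<in> neighbors G x"
    and "u \<noteq> w" "u \<in> pverts G - B" "w \<in> pverts G - B"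
  shows "pt_set G B = \<infinity>"
  using unfilled_twins[OF assms(1), of B] assms(2-4) by (auto simp: pt_set_def)

section \<open>Throttling when all vertices but one are twins\<close>

text \<open>These conditions are preserved by complementation, so one computation serves both a star
  and its complement.\<close>

locale twin_graph = pair_graph G for G :: "'a pair_pre_digraph" (structure) +
  fixes c :: 'a
  assumes center: "c \<in> pverts G"
    and order_ge: "order G \<ge> 3"
    and twins: "\<lbrakk>u \<in> pverts G - {c}; w \<in> pverts G - {c}; x \<noteq> u; x \<noteq> w\<rbrakk>
      \<Longrightarrow> (x, u) \<in> parcs G \<longleftrightarrow> (x, w) \<in> parcs G"
begin

lemma neighbors_twins:
  assumes "u \<in> pverts G - {c}" "w \<in> pverts G - {c}" "x \<noteq> u" "x \<noteq> w"
  shows "u \<in> neighbors G x \<longleftrightarrow> w \<in> neighbors G x"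
  using twins[OF assms] by (simp add: neighbors_def)

lemma pt_set_two_missing:
  assumes "u \<in> pverts G - {c}" "w \<in> pverts G - {c}" "u \<noteq> w" "u \<notin> B" "w \<notin> B"
  shows "pt_set G B = \<infinity>"
  using assms by (intro pt_set_twins[of u w] neighbors_twins) auto

lemma pt_set_few:
  assumes "B \<subseteq> pverts G" "card B + 3 \<le> order G"
  shows "pt_set G B = \<infinity>"
proof -
  have "card (pverts G - B) = order G - card B"
    using assms(1) by (intro card_Diff_subset) (auto intro: finite_subset)
  \<comment> \<open>Of at least three unfilled vertices, at least two remain after discarding
    \<open>c\<close>, and these are twins.\<close>
  then have "\<not> card (pverts G - B - {c}) \<le> Suc 0"
    using assms(2) card_Diff_singleton_if[of "pverts G - B" c] by (auto split: if_splits)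
  then obtain u w where "u \<in> pverts G - B - {c}" "w \<in> pverts G - B - {c}" "u \<noteq> w"
    by (auto simp: card_le_Suc0_iff_eq)
  then show ?thesis by (intro pt_set_two_missing) auto
qed

lemma pt_set_all_but_two:
  assumes "B \<subseteq> pverts G" "card B + 2 = order G"
  shows "2 \<le> pt_set G B"
proof -
  have "card (pverts G - B) = order G - card B"
    using assms(1) by (intro card_Diff_subset) (auto intro: finite_subset)
  then have "card (pverts G - B) = 2"
    using assms(2) by simp
  then obtain u w where uw: "pverts G - B = {u, w}" "u \<noteq> w"
    by (auto simp: card_2_iff)
  show ?thesis
  proof (cases "c \<in> {u, w}")
    case False
    then have "pt_set G B = \<infinity>"
      using uw by (intro pt_set_two_missing[of u w]) auto
    then show ?thesis by simp
  next
    case True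
    with uw obtain v where v: "pverts G - B = {c, v}" "v \<noteq> c" by auto
    have False if step: "zf_step G B = pverts G"
    proof -
      have "c \<in> zf_step G B" "v \<in> zf_step G B" "c \<notin> B" "v \<notin> B"
        using v step by auto
      then obtain x y where x: "x \<in> B" "neighbors G x - B = {c}"
        and y: "y \<in> B" "neighbors G y - B = {v}"
        by (auto simp: zf_step_def)
      have "(c, x) \<in> parcs G"
        using x(2) arcs_symmetric by (auto simp: neighbors_def)
      moreover have "x \<in> pverts G - {c}" "y \<in> pverts G - {c}"
        using x(1) y(1) assms(1) \<open>c \<notin> B\<close> by auto
      \<comment> \<open>Away from the center, \<open>x\<close> and \<open>y\<close> are twins, so
        \<open>c\<close> is adjacent to \<open>y\<close> as it is to \<open>x\<close>. Then
        \<open>y\<close> has both \<open>c\<close> and \<open>v\<close> as unfilled neighbors and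
        cannot force \<open>v\<close>.\<close>
      ultimately have "(c, y) \<in> parcs G"
        using twins[of x y c] by auto
      then have "c \<in> neighbors G y - B"
        using arcs_symmetric \<open>c \<notin> B\<close> by (auto simp: neighbors_def)
      with y(2) v(2) show False by auto
    qed
    moreover have "B \<noteq> pverts G" using v by auto
    \<comment> \<open>Time 0 would mean that \<open>B\<close> is everything, and time 1 is the
      single round just excluded.\<close>
    ultimately have "2 \<le> t" if "zf_iter G B t = pverts G" for t
      using that by (cases t rule: nat.exhaust; cases "t - 1"; auto)
    then have "enat 2 \<le> pt_set G B" by (rule pt_set_ge)
    then show ?thesis by (simp add: numeral_eq_enat)
  qed
qed

lemma pt_set_proper:
  assumes "B \<subset> pverts G"
  shows "1 \<le> pt_set G B"
proof -
  have "1 \<le> t" if "zf_iter G B t = pverts G" for t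
    using that assms by (cases t) auto
  then have "enat 1 \<le> pt_set G B" by (rule pt_set_ge)
  then show ?thesis by (simp add: one_enat_def)
qed

lemma pt_few:
  assumes "k + 3 \<le> order G"
  shows "pt G k = \<infinity>"
proof -
  have "\<infinity> \<le> pt G k"
    using assms pt_set_few by (intro pt_ge) auto
  then show ?thesis by simp
qed

lemma pt_all_but_two: "2 \<le> pt G (order G - 2)"
  using order_ge pt_set_all_but_two by (intro pt_ge) auto

lemma pt_all_but_one: "1 \<le> pt G (order G - 1)"
proof (rule pt_ge)
  fix B assume "B \<subseteq> pverts G" "card B = order G - 1"
  then have "B \<subset> pverts G" using order_ge by auto
  then show "1 \<le> pt_set G B" by (rule pt_set_proper)
qed auto

lemma th_eq: "th G = enat (order G)"
proof (rule antisym)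
  show "th G \<le> enat (order G)"
    using th_le_order[OF pair_finite_verts] order_ge by linarith
  have "enat (order G) \<le> enat k + pt G k" if k: "k \<in> {1..order G}" for k
  proof -
    \<comment> \<open>The cases are three or more, two, one or no unfilled vertices. The propagation
      time is infinite in the first case and otherwise at least the number of unfilled vertices, so
      the sum never drops below the order.\<close>
    consider "k + 3 \<le> order G" | "k = order G - 2" | "k = order G - 1" | "k = order G"
      using k by fastforce
    then show ?thesis
    proof cases
      case 2
      have "enat (order G) = enat k + 2"
        using 2 order_ge by (simp add: numeral_eq_enat)
      also have "\<dots> \<le> enat k + pt G k"
        using 2 pt_all_but_two by (simp add: add_left_mono)
      finally show ?thesis .
    next
      case 3
      have "enat (order G) = enat k + 1"
        using 3 order_ge by (simp add: one_enat_def)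
      also have "\<dots> \<le> enat k + pt G k"
        using 3 pt_all_but_one by (simp add: add_left_mono)
      finally show ?thesis .
    qed (auto simp: pt_few)
  qed
  moreover have "order G \<ge> 1"
    using order_ge by simp
  ultimately show "enat (order G) \<le> th G"
    by (intro th_ge)
qed

lemma th_star_eq:
  assumes "has_edge G"
  shows "th_star G = enat (order G - 1)"
proof (rule antisym)
  show "th_star G \<le> enat (order G - 1)"
    using pair_graph_axioms assms by (rule th_star_le_order)
  have "enat (order G - 1) \<le> enat k * pt G k" if k: "k \<in> {1..order G - 1}" for k
  proof -
    consider "k + 3 \<le> order G" | "k = order G - 2" | "k = order G - 1"
      using k by fastforce
    then show ?thesis
    proof cases
      case 1
      \<comment> \<open>Here \<open>k\<close> must be positive, since the product of 0 and
        \<infinity> is 0 in \<open>enat\<close>.\<close>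
      then have "enat k * pt G k = \<infinity>"
        using k by (simp add: pt_few zero_enat_def)
      then show ?thesis by simp
    next
      case 2
      \<comment> \<open>For order n this is n - 1 \<le> 2 (n - 2), which holds exactly because n is
        at least 3.\<close>
      have "enat (order G - 1) \<le> enat k * 2"
        using 2 order_ge by (simp add: numeral_eq_enat)
      also have "\<dots> \<le> enat k * pt G k"
        using 2 pt_all_but_two by (intro mult_left_mono) auto
      finally show ?thesis .
    next
      case 3
      have "enat (order G - 1) = enat k * 1"
        using 3 by simp
      also have "\<dots> \<le> enat k * pt G k"
        using 3 pt_all_but_one by (intro mult_left_mono) auto
      finally show ?thesis .
    qed
  qed
  moreover have "order G \<ge> 2"
    using order_ge by simp
  ultimately show "enat (order G - 1) \<le> th_star G"
    by (intro th_star_ge)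
qed

text \<open>For \<open>x\<close> different from \<open>u\<close> and \<open>w\<close>, passing to
  the complement negates both sides of the twin equivalence.\<close>

lemma twin_graph_complement: "twin_graph (complement G) c"
proof -
  interpret C: pair_graph "complement G"
    by (rule pair_graph_complement) unfold_locales
  show ?thesis
  proof unfold_locales
    fix u w x
    assume "u \<in> pverts (complement G) - {c}" "w \<in> pverts (complement G) - {c}" "x \<noteq> u" "x \<noteq> w"
    moreover from this have "(x, u) \<in> parcs G \<longleftrightarrow> (x, w) \<in> parcs G"
      by (intro twins) simp_all
    ultimately show "(x, u) \<in> parcs (complement G) \<longleftrightarrow> (x, w) \<in> parcs (complement G)"
      by (simp add: complement_def)
  qed (use center order_ge in simp_all)
qed

end

section \<open>Stars as extremal graphs\<close>

definition star :: "nat \<Rightarrow> nat pair_pre_digraph" where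
  "star n = \<lparr> pverts = {0..n}, parcs = {0} \<times> {1..n} \<union> {1..n} \<times> {0} \<rparr>"

lemma order_star: "order (star n) = Suc n"
  by (simp add: star_def)

lemma twin_graph_star:
  assumes "n \<ge> 2"
  shows "twin_graph (star n) 0"
  using assms by unfold_locales (auto simp: star_def symmetric_def intro!: symI)

lemma has_edge_star:
  assumes "n \<ge> 2"
  shows "has_edge (star n)" "has_edge (complement (star n))"
proof -
  \<comment> \<open>Two leaves are needed for the complement, where they become adjacent.\<close>
  have "(0, 1) \<in> parcs (star n)" "(1, 2) \<in> parcs (complement (star n))"
    using assms by (auto simp: star_def complement_def)
  then show "has_edge (star n)" "has_edge (complement (star n))"
    by (auto simp: has_edge_def)
qed

text \<open>An isomorphism maps the vertex set bijectively; this invariant is what tells different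
  stars apart.\<close>

lemma digraph_iso_order:
  assumes "digraph_iso (with_proj G) (with_proj H)"
  shows "order G = order H"
proof -
  obtain f where "pre_digraph.digraph_isomorphism (with_proj G) f"
    and H: "with_proj H = app_iso f (with_proj G)"
    using assms by (auto simp: digraph_iso_def)
  then have "inj_on (iso_verts f) (pverts G)"
    by (simp add: pre_digraph.digraph_isomorphism_def)
  moreover have "pverts H = iso_verts f ` pverts G"
    using arg_cong[OF H, of verts] by (simp add: app_iso_def)
  ultimately show ?thesis by (simp add: card_image)
qed

text \<open>Stars of different sizes have different orders, so they form an infinite family of
  pairwise nonisomorphic graphs.\<close>

lemma infinitely_many_graphs_star:
  assumes "\<And>n. n \<ge> 2 \<Longrightarrow> P (star n)"
  shows "infinitely_many_graphs P"
  unfolding infinitely_many_graphs_def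
proof (intro exI[of _ "star ` {2..}"] conjI ballI impI)
  have "inj_on star {2..}"
    by (metis inj_onI order_star nat.inject)
  then show "infinite (star ` {2..})"
    using infinite_Ici finite_imageD by blast
next
  fix G assume "G \<in> star ` {2..}"
  then obtain n where n: "G = star n" "n \<ge> 2" by auto
  interpret twin_graph "star n" 0 using n(2) by (rule twin_graph_star)
  show "pair_graph G" unfolding n(1) by unfold_locales
  show "pverts G \<noteq> {}" using center n(1) by auto
  show "P G" using assms n by simp
next
  fix G H assume "G \<in> star ` {2..}" "H \<in> star ` {2..}" "G \<noteq> H"
  then have "order G \<noteq> order H" by (auto simp: order_star)
  then show "\<not> digraph_iso (with_proj G) (with_proj H)"
    using digraph_iso_order by blast
qed

lemma throttling_star:
  assumes "n \<ge> 2"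
  shows "th (star n) = enat (Suc n)" "th (complement (star n)) = enat (Suc n)"
    "th_star (star n) = enat n" "th_star (complement (star n)) = enat n"
proof -
  interpret twin_graph "star n" 0 using assms by (rule twin_graph_star)
  interpret C: twin_graph "complement (star n)" 0 by (rule twin_graph_complement)
  show "th (star n) = enat (Suc n)" "th (complement (star n)) = enat (Suc n)"
    "th_star (star n) = enat n" "th_star (complement (star n)) = enat n"
    using th_eq C.th_eq th_star_eq C.th_star_eq has_edge_star[OF assms]
    by (simp_all add: order_star)
qed

section \<open>Bounds for a graph and its complement, and their sharpness\<close>

lemma throttling_bounds:
  assumes "pair_graph G" "order G \<ge> 2"
  shows "th G * th (complement G) \<le> enat ((order G)\<^sup>2)"
    and "has_edge G \<Longrightarrow> has_edge (complement G) \<Longrightarrow>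
      th_star G + th_star (complement G) \<le> enat (2 * (order G - 1))"
    and "has_edge G \<Longrightarrow> has_edge (complement G) \<Longrightarrow>
      th_star G * th_star (complement G) \<le> enat ((order G - 1)\<^sup>2)"
proof -
  interpret pair_graph G by fact
  have "th G \<le> enat (order G)" "th (complement G) \<le> enat (order G)"
    using th_le_order[of G] th_le_order[of "complement G"] assms(2) by auto
  from mult_mono[OF this] show "th G * th (complement G) \<le> enat ((order G)\<^sup>2)"
    by (simp add: power2_eq_square)
  assume "has_edge G" "has_edge (complement G)"
  then have le: "th_star G \<le> enat (order G - 1)" "th_star (complement G) \<le> enat (order G - 1)"
    using th_star_le_order[OF assms(1)] th_star_le_order[OF pair_graph_complement[OF assms(1)]]
    by auto
  from add_mono[OF le] show "th_star G + th_star (complement G) \<le> enat (2 * (order G - 1))"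
    by (simp add: mult_2)
  from mult_mono[OF le] show "th_star G * th_star (complement G) \<le> enat ((order G - 1)\<^sup>2)"
    by (simp add: power2_eq_square)
qed

theorem proposition2p3:
  shows "(\<forall>G :: 'a pair_pre_digraph. pair_graph G \<and> order G \<ge> 2 \<longrightarrow>
      th G * th (complement G) \<le> enat ((order G)\<^sup>2) \<and>
      (has_edge G \<and> has_edge (complement G) \<longrightarrow>
        th_star G + th_star (complement G) \<le> enat (2 * (order G - 1)) \<and>
        th_star G * th_star (complement G) \<le> enat ((order G - 1)\<^sup>2)))
    \<and> infinitely_many_graphs (\<lambda>G. order G \<ge> 2 \<and>
        th G * th (complement G) = enat ((order G)\<^sup>2))
    \<and> infinitely_many_graphs (\<lambda>G. order G \<ge> 2 \<and> has_edge G \<and> has_edge (complement G) \<and>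
        th_star G + th_star (complement G) = enat (2 * (order G - 1)))
    \<and> infinitely_many_graphs (\<lambda>G. order G \<ge> 2 \<and> has_edge G \<and> has_edge (complement G) \<and>
        th_star G * th_star (complement G) = enat ((order G - 1)\<^sup>2))"
\<comment> \<open>Each sharpness claim reduces to \<open>star n\<close> with n \<ge> 2, whose order
  is n + 1; the attained values are (n + 1)^2, 2 n and n^2.\<close>
proof (intro conjI allI impI infinitely_many_graphs_star)
  fix G :: "'a pair_pre_digraph"
  assume G: "pair_graph G \<and> order G \<ge> 2"
  then show "th G * th (complement G) \<le> enat ((order G)\<^sup>2)"
    using throttling_bounds(1) by blast
  assume "has_edge G \<and> has_edge (complement G)"
  with G show "th_star G + th_star (complement G) \<le> enat (2 * (order G - 1))"
    "th_star G * th_star (complement G) \<le> enat ((order G - 1)\<^sup>2)"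
    using throttling_bounds(2,3) by blast+
qed (simp_all add: throttling_star has_edge_star order_star power2_eq_square)

end
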